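(* For $A \in \mathrm{M}_n(\mathbb{C})$ and $d\geq 2$ even, $$|\!|\!| A |\!|\!|_d \geq \binom{n+d-1}{d}^{1/d} \frac{| \operatorname{tr} A|}{n},$$ with equality if and only if $A$ is a multiple of the identity.
   Context: $\mathrm{M}_n(\mathbb{C})$ is the space of $n\times n$ complex matrices and $A^*$ is the conjugate transpose of $A$. For even $d\ge2$, the norm $|\!|\!|\cdot|\!|\!|_d$ on $\mathrm{M}_n(\mathbb{C})$ is defined by $$|\!|\!| A |\!|\!|_{d}= \bigg( \sum_{\boldsymbol{\pi} \,\vdash\, d} \frac{\mathrm{T}_{\boldsymbol{\pi}}(A)}{z_{\boldsymbol{\pi}}}\bigg)^{1/d},$$ where the sum runs over all partitions $\boldsymbol{\pi}=(\pi_1,\ldots,\pi_r)$ of $d$ ($\pi_1\ge\cdots\ge\pi_r\ge1$, $\sum_j\pi_j=d$); $z_{\boldsymbol{\pi}}=\prod_{i\ge1} i^{m_i}m_i!$ with $m_i$ the multiplicity of $i$ in $\boldsymbol{\pi}$; and $\mathrm{T}_{\boldsymbol{\pi}}(A)$ is $1/\binom{d}{d/2}$ times the sum, over the $\binom{d}{d/2}$ ways to choose $d/2$ of the $d$ copies of $A$ in $(\operatorname{tr}A^{\pi_1})(\operatorname{tr}A^{\pi_2})\cdots(\operatorname{tr}A^{\pi_r})$ (each power written out as a product of copies of $A$) and replace them by $A^*$, of the resulting expressions. *)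

theory Defs
  imports "Jordan_Normal_Form.Schur_Decomposition"
begin

definition partitions :: "nat \<Rightarrow> nat list set" where
  "partitions d = {p. sorted_wrt (\<ge>) p \<and> (\<forall>k\<in>set p. 1 \<le> k) \<and> sum_list p = d}"

lemma finite_partitions: "finite (partitions d)"
proof (rule finite_subset)
  show "partitions d \<subseteq> {p. set p \<subseteq> {..d} \<and> length p \<le> d}"
  proof (safe, goal_cases)
    case (1 p x)
    then show ?case by (auto simp: partitions_def member_le_sum_list)
  next
    case (2 p)
    then have "\<forall>k\<in>set p. 1 \<le> k" "sum_list p = d" by (auto simp: partitions_def)
    then show ?case by (induction p arbitrary: d) force+
  qed
qed (rule finite_lists_length_le, simp)

text \<open>Only the \<open>i\<close> that occur in \<open>p\<close> are needed: every other \<open>i\<close> contributes \<open>i ^ 0 * fact 0 = 1\<close>.\<close>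

definition z_part :: "nat list \<Rightarrow> nat" where
  "z_part p = (\<Prod>i\<in>set p. i ^ count_list p i * fact (count_list p i))"

definition mat_trace :: "'a :: comm_monoid_add mat \<Rightarrow> 'a" where
  "mat_trace A = (\<Sum>i<dim_row A. A $$ (i, i))"

text \<open>
  The position \<open>(j, i)\<close> stands for the \<open>i\<close>-th copy of \<open>A\<close> in the \<open>j\<close>-th trace of
  \<open>tr (A ^ p\<^sub>0) * tr (A ^ p\<^sub>1) * \<dots>\<close>, counting from 0; \<open>S\<close> is the set of positions at which \<open>A\<close> is
  replaced by its adjoint.
\<close>

definition positions :: "nat list \<Rightarrow> (nat \<times> nat) set" where
  "positions p = (SIGMA j:{..<length p}. {..<p ! j})"

definition block_word :: "complex mat \<Rightarrow> (nat \<times> nat) set \<Rightarrow> nat \<Rightarrow> nat \<Rightarrow> complex mat" where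
  "block_word A S j k =
     foldr (*) (map (\<lambda>i. if (j, i) \<in> S then mat_adjoint A else A) [0..<k]) (1\<^sub>m (dim_row A))"

definition T_part :: "nat list \<Rightarrow> complex mat \<Rightarrow> complex" where
  "T_part p A =
     (\<Sum>S | S \<subseteq> positions p \<and> card S = sum_list p div 2.
        \<Prod>j<length p. mat_trace (block_word A S j (p ! j)))
     / of_nat (sum_list p choose (sum_list p div 2))"

lemma finite_positions: "finite (positions p)"
  by (simp add: positions_def)

lemma card_positions: "card (positions p) = sum_list p"
  by (simp add: positions_def sum_list_sum_nth atLeast0LessThan)

lemma card_selections:
  "card {S. S \<subseteq> positions p \<and> card S = k} = sum_list p choose k"
  using n_subsets[OF finite_positions] by (simp add: card_positions)

lemma mat_adjoint_carrier:
  fixes B :: "complex mat"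
  assumes "B \<in> carrier_mat n m"
  shows "mat_adjoint B \<in> carrier_mat m n"
  using assms by (auto simp: mat_adjoint_def)

lemma mat_adjoint_index:
  fixes B :: "complex mat"
  assumes "B \<in> carrier_mat n m" "i < m" "j < n"
  shows "mat_adjoint B $$ (i, j) = cnj (B $$ (j, i))"
  using assms by (auto simp: mat_adjoint_def mat_of_rows_index)

lemma mat_adjoint_adjoint:
  fixes B :: "complex mat"
  assumes "B \<in> carrier_mat n n"
  shows "mat_adjoint (mat_adjoint B) = B"
  using mat_adjoint_carrier[OF mat_adjoint_carrier[OF assms]] mat_adjoint_carrier[OF assms] assms
  by (intro eq_matI) (auto simp: mat_adjoint_index[of _ n n])

lemma mat_adjoint_one: "mat_adjoint (1\<^sub>m n :: complex mat) = 1\<^sub>m n"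
  using mat_adjoint_carrier[OF one_carrier_mat[of n]]
  by (intro eq_matI) (auto simp: mat_adjoint_index[of _ n n])

lemma mat_adjoint_times:
  fixes B C :: "complex mat"
  assumes "B \<in> carrier_mat n n" "C \<in> carrier_mat n n"
  shows "mat_adjoint (B * C) = mat_adjoint C * mat_adjoint B"
proof (rule eq_matI)
  note c = assms mat_adjoint_carrier[OF assms(1)] mat_adjoint_carrier[OF assms(2)]
  show "dim_row (mat_adjoint (B * C)) = dim_row (mat_adjoint C * mat_adjoint B)"
    "dim_col (mat_adjoint (B * C)) = dim_col (mat_adjoint C * mat_adjoint B)"
    using c mat_adjoint_carrier[of "B * C" n n] by auto
  fix i j
  assume "i < dim_row (mat_adjoint C * mat_adjoint B)" "j < dim_col (mat_adjoint C * mat_adjoint B)"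
  then have ij: "i < n" "j < n" using c by auto
  then show "mat_adjoint (B * C) $$ (i, j) = (mat_adjoint C * mat_adjoint B) $$ (i, j)"
    using c by (subst mat_adjoint_index[of _ n n])
      (auto simp: scalar_prod_def mat_adjoint_index[of _ n n] mult.commute intro!: sum.cong)
qed

lemma mat_trace_adjoint:
  fixes B :: "complex mat"
  assumes "B \<in> carrier_mat n n"
  shows "mat_trace (mat_adjoint B) = cnj (mat_trace B)"
  using assms mat_adjoint_carrier[OF assms]
  by (auto simp: mat_trace_def mat_adjoint_index[of _ n n])

lemma foldr_mat_carrier:
  assumes "set ws \<subseteq> carrier_mat n n"
  shows "foldr (*) ws (1\<^sub>m n :: complex mat) \<in> carrier_mat n n"
  using assms by (induction ws) auto

lemma foldr_mat_snoc:
  fixes B :: "complex mat"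
  assumes "set ws \<subseteq> carrier_mat n n" "B \<in> carrier_mat n n"
  shows "foldr (*) (ws @ [B]) (1\<^sub>m n) = foldr (*) ws (1\<^sub>m n) * B"
  using assms
proof (induction ws)
  case (Cons C ws)
  then show ?case using foldr_mat_carrier[of ws n] by (simp add: assoc_mult_mat[of _ n n])
qed simp

lemma mat_adjoint_foldr:
  assumes "set ws \<subseteq> carrier_mat n n"
  shows "mat_adjoint (foldr (*) ws (1\<^sub>m n :: complex mat)) = foldr (*) (rev (map mat_adjoint ws)) (1\<^sub>m n)"
  using assms
proof (induction ws)
  case (Cons C ws)
  have "set (rev (map mat_adjoint ws)) \<subseteq> carrier_mat n n"
    using Cons.prems by (auto intro: mat_adjoint_carrier)
  then show ?case
    using Cons foldr_mat_carrier[of ws n]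
    by (simp add: foldr_mat_snoc mat_adjoint_times[of _ n] mat_adjoint_carrier del: foldr_append)
qed (simp add: mat_adjoint_one)

text \<open>
  Conjugating a trace reverses its word and exchanges \<open>A\<close> with its adjoint. If \<open>d\<close> is even, this
  permutes the selections of \<open>d / 2\<close> positions, so \<open>T_part p A\<close> is real.
\<close>

definition flip :: "nat list \<Rightarrow> (nat \<times> nat) set \<Rightarrow> (nat \<times> nat) set" where
  "flip p S = {(j, i) \<in> positions p. (j, p ! j - 1 - i) \<notin> S}"

lemma flip_flip: "S \<subseteq> positions p \<Longrightarrow> flip p (flip p S) = S"
  by (auto simp: flip_def positions_def)

lemma card_flip:
  assumes "S \<subseteq> positions p"
  shows "card (flip p S) = sum_list p - card S"
proof -
  let ?r = "\<lambda>(j, i). (j, p ! j - 1 - i)"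
  have "inj_on ?r (positions p - S)"
    by (rule inj_onI) (auto simp: positions_def)
  moreover have "flip p S = ?r ` (positions p - S)"
  proof (intro equalityI subsetI)
    fix x assume "x \<in> flip p S"
    then show "x \<in> ?r ` (positions p - S)"
      by (intro image_eqI[of _ _ "?r x"]) (auto simp: flip_def positions_def)
  qed (auto simp: flip_def positions_def)
  ultimately have "card (flip p S) = card (positions p - S)"
    by (simp add: card_image)
  then show ?thesis
    using assms finite_positions by (simp add: card_Diff_subset finite_subset card_positions)
qed

lemma cnj_trace_block:
  assumes A: "A \<in> carrier_mat n n" and j: "j < length p"
  shows "cnj (mat_trace (block_word A S j (p ! j))) = mat_trace (block_word A (flip p S) j (p ! j))"
proof -
  let ?f = "\<lambda>S i. if (j, i) \<in> S then mat_adjoint A else A"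
  have ws: "set (map (?f S) [0..<p ! j]) \<subseteq> carrier_mat n n"
    using A by (auto intro: mat_adjoint_carrier)
  have "rev (map mat_adjoint (map (?f S) [0..<p ! j])) = map (?f (flip p S)) [0..<p ! j]"
    using j A by (intro nth_equalityI)
      (auto simp: rev_nth flip_def positions_def mat_adjoint_adjoint)
  then have "mat_adjoint (block_word A S j (p ! j)) = block_word A (flip p S) j (p ! j)"
    using A mat_adjoint_foldr[OF ws] by (simp add: block_word_def)
  moreover have "block_word A S j (p ! j) \<in> carrier_mat n n"
    using A foldr_mat_carrier[OF ws] by (simp add: block_word_def)
  ultimately show ?thesis using mat_trace_adjoint by metis
qed

lemma T_part_real:
  assumes A: "A \<in> carrier_mat n n" and ev: "even (sum_list p)"
  shows "T_part p A \<in> \<real>"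
proof -
  let ?F = "{S. S \<subseteq> positions p \<and> card S = sum_list p div 2}"
  let ?g = "\<lambda>S. \<Prod>j<length p. mat_trace (block_word A S j (p ! j))"
  have flip: "flip p S \<in> ?F" if "S \<in> ?F" for S
    using that ev card_flip[of S p] by (auto simp: flip_def)
  have "(\<Sum>S\<in>?F. cnj (?g S)) = (\<Sum>S\<in>?F. ?g S)"
  proof (rule sum.reindex_bij_witness[of _ "flip p" "flip p"])
    show "?g (flip p S) = cnj (?g S)" for S
      by (simp add: cnj_trace_block[OF A])
  qed (use flip flip_flip in auto)
  then show ?thesis
    unfolding T_part_def by (intro Reals_divide) (simp_all add: Reals_cnj_iff)
qed

text \<open>By \<open>T_part_real\<close> the sum is real for even \<open>d\<close>, so taking \<open>Re\<close> discards nothing.\<close>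

definition chs_norm :: "nat \<Rightarrow> complex mat \<Rightarrow> real" where
  "chs_norm d A = root d (Re (\<Sum>p\<in>partitions d. T_part p A / of_nat (z_part p)))"

end

theory Submission
  imports Defs "HOL-Computational_Algebra.Formal_Power_Series"
begin

text \<open>
  Write \<open>F(B)\<close> for the sum over the partitions of \<open>d\<close> of \<open>tr (B ^ p\<^sub>0) * tr (B ^ p\<^sub>1) * \<dots> / z\<^sub>p\<close>. If \<open>B\<close> is
  Hermitian with eigenvalues \<open>\<lambda>\<^sub>1, \<dots>, \<lambda>\<^sub>n\<close>, then \<open>F(B)\<close> is the complete homogeneous symmetric
  polynomial \<open>h\<^sub>d\<close> of the eigenvalues, because both sides satisfy Newton's recurrence
  (\<open>cycle_sum_power_sums\<close>).
  
  For even \<open>d\<close> and real arguments with a given sum, \<open>h\<^sub>d\<close> is smallest exactly when all arguments are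
  equal (\<open>homog_less_of_not_constant\<close>). Indeed, moving two arguments towards each other with their sum
  fixed decreases \<open>h\<^sub>d\<close> by a positive multiple of \<open>h\<^sub>d\<^sub>-\<^sub>2\<close> of a longer list of arguments
  (\<open>homog_smoothing\<close>), and complete homogeneous polynomials of even degree are positive away from 0
  (\<open>homog_even_pos\<close>). The positivity rests on a one-line fact about real polynomials: if \<open>g\<close> has even
  degree and positive leading coefficient and \<open>g - a g'\<close> is positive, then so is \<open>g\<close>, since
  \<open>g' = 0\<close> at its minimum. The common value at equal arguments \<open>\<mu>\<close> is
  \<open>((n + d - 1) choose d) * \<mu> ^ d\<close>, which is the theorem for Hermitian matrices
  (\<open>hermitian_cycle_trace\<close>).
  
  A general \<open>A\<close> is reduced to the Hermitian matrices \<open>B z = z A + cnj z A\<^sup>*\<close> with \<open>cmod z = 1\<close>.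
  Expanding \<open>F(B z)\<close> and averaging over the \<open>(d + 1)\<close>-th roots of unity keeps the terms with equally
  many factors \<open>A\<close> and \<open>A\<^sup>*\<close>, so the average is the \<open>d\<close>-th power of the norm of \<open>A\<close> times
  \<open>d choose (d div 2)\<close> (\<open>average_cycle_trace\<close>). The average of \<open>(tr (B z)) ^ d\<close> is
  \<open>cmod (tr A) ^ d\<close> times the same binomial coefficient (\<open>average_trace_power\<close>). Averaging the
  Hermitian inequality gives the result. In the case of equality every \<open>B z\<close> is a scalar matrix, and
  two values of \<open>z\<close> suffice to recover \<open>A\<close> (\<open>scalar_of_rotated_real_parts\<close>).
\<close>

section \<open>Complete homogeneous symmetric polynomials\<close>

definition homog_gf :: "real multiset \<Rightarrow> real fps" where
  "homog_gf M = (\<Prod>x\<in>#M. inverse (1 - fps_const x * fps_X))"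

text \<open>
  The complete homogeneous symmetric polynomial of degree \<open>d\<close>, evaluated at the elements of \<open>M\<close>.
\<close>

definition homog :: "real multiset \<Rightarrow> nat \<Rightarrow> real" where
  "homog M d = fps_nth (homog_gf M) d"

lemma homog_gf_add:
  "(1 - fps_const x * fps_X) * homog_gf (add_mset x M) = homog_gf M"
proof -
  have "(1 - fps_const x * fps_X) * inverse (1 - fps_const x * fps_X) = (1 :: real fps)"
    by (subst mult.commute, rule inverse_mult_eq_1) simp
  then show ?thesis
    by (simp add: homog_gf_def mult.assoc[symmetric])
qed

lemma homog_empty: "homog {#} d = (if d = 0 then 1 else 0)"
  by (simp add: homog_def homog_gf_def)

lemma homog_0 [simp]: "homog M 0 = 1"
  by (induction M) (simp_all add: homog_def homog_gf_def)

lemma homog_add_Suc: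
  "homog (add_mset x M) (Suc d) = homog M (Suc d) + x * homog (add_mset x M) d"
  using arg_cong[OF homog_gf_add[of x M], of "\<lambda>f. fps_nth f (Suc d)"]
  by (simp add: homog_def algebra_simps)

text \<open>
  This is \<open>t H'(t) = (\<Sum>x\<in>#M. x t / (1 - x t)) H(t)\<close> for the generating function \<open>H\<close>, read off
  coefficientwise. Together with the value 1 in degree 0 it determines every \<open>homog M d\<close> from the
  power sums of \<open>M\<close>.
\<close>

lemma newton_homog: "of_nat d * homog M d = (\<Sum>k=1..d. (\<Sum>x\<in>#M. x ^ k) * homog M (d - k))"
proof (induction M arbitrary: d)
  case empty
  then show ?case by (simp add: homog_empty)
next
  case (add a M)
  show ?case
  proof (induction d)
    case (Suc d)
    let ?N = "add_mset a M" and ?p = "\<lambda>k. \<Sum>x\<in>#M. x ^ k"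
    \<comment> \<open>Every occurrence of \<open>homog ?N\<close> in positive degree is traded for \<open>homog M\<close>; only the term \<open>k = Suc d\<close> has degree 0.\<close>
    have split: "(\<Sum>k=1..Suc d. c k * homog ?N (Suc d - k))
        = (\<Sum>k=1..Suc d. c k * homog M (Suc d - k)) + a * (\<Sum>k=1..d. c k * homog ?N (d - k))"
      for c :: "nat \<Rightarrow> real"
    proof -
      have "(\<Sum>k=1..d. c k * homog ?N (Suc d - k))
          = (\<Sum>k=1..d. c k * homog M (Suc d - k)) + a * (\<Sum>k=1..d. c k * homog ?N (d - k))"
        unfolding sum_distrib_left sum.distrib[symmetric]
        by (intro sum.cong) (auto simp: Suc_diff_le homog_add_Suc algebra_simps)
      then show ?thesis by simp
    qed
    have geom: "(\<Sum>k=1..Suc d. a ^ k * homog M (Suc d - k)) = a * homog ?N d"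
    proof (induction d)
      case (Suc d)
      have "(\<Sum>k=1..Suc (Suc d). a ^ k * homog M (Suc (Suc d) - k))
          = a * homog M (Suc d) + (\<Sum>k=1..Suc d. a ^ Suc k * homog M (Suc d - k))"
        by (subst sum.atLeast_Suc_atMost, simp, subst sum.shift_bounds_cl_Suc_ivl) simp
      also have "\<dots> = a * (homog M (Suc d) + (\<Sum>k=1..Suc d. a ^ k * homog M (Suc d - k)))"
        by (simp add: sum_distrib_left algebra_simps)
      finally show ?case using Suc by (simp add: homog_add_Suc)
    qed (simp add: homog_empty)
    have "(\<Sum>k=1..Suc d. (\<Sum>x\<in>#?N. x ^ k) * homog M (Suc d - k))
        = (\<Sum>k=1..Suc d. a ^ k * homog M (Suc d - k)) + (\<Sum>k=1..Suc d. ?p k * homog M (Suc d - k))"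
      unfolding sum.distrib[symmetric] by (intro sum.cong) (auto simp: distrib_right)
    also have "\<dots> = a * homog ?N d + of_nat (Suc d) * homog M (Suc d)"
      by (simp only: geom add[of "Suc d"])
    finally have "(\<Sum>k=1..Suc d. (\<Sum>x\<in>#?N. x ^ k) * homog ?N (Suc d - k))
        = a * homog ?N d + of_nat (Suc d) * homog M (Suc d) + a * (of_nat d * homog ?N d)"
      by (simp only: split Suc)
    then show ?case
      by (simp only: homog_add_Suc) (simp add: algebra_simps)
  qed simp
qed

lemma homog_replicate:
  assumes "1 \<le> n"
  shows "homog (replicate_mset n \<mu>) d = real ((n + d - 1) choose d) * \<mu> ^ d"
  using assms
proof (induction n arbitrary: d rule: dec_induct)
  case base
  show ?case by (induction d) (simp_all add: homog_add_Suc homog_empty)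
next
  case (step n)
  show ?case
  proof (induction d)
    case (Suc d)
    have "(Suc n + Suc d - 1) choose Suc d = ((n + Suc d - 1) choose Suc d) + ((Suc n + d - 1) choose d)"
      by simp
    then show ?case
      using Suc step.IH[of "Suc d"] by (simp add: homog_add_Suc algebra_simps)
  qed simp
qed

text \<open>
  Write \<open>l a = 1 - a t\<close>. Since \<open>x + y = u + v\<close>, the products \<open>l u * l v\<close> and \<open>l x * l y\<close> differ only
  in the coefficient of \<open>t\<^sup>2\<close>. Dividing by all four factors gives
  \<open>1 / (l x * l y) - 1 / (l u * l v) = (u v - x y) t\<^sup>2 / (l x * l y * l u * l v)\<close>, so the effect of
  replacing a pair by another one of equal sum is again a complete homogeneous polynomial, two
  degrees lower.
\<close>

lemma homog_smoothing:
  assumes "x + y = u + v"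
  shows "homog ({#x, y#} + R) (Suc (Suc d)) - homog ({#u, v#} + R) (Suc (Suc d))
    = (u * v - x * y) * homog ({#x, y, u, v#} + R) d"
proof -
  let ?l = "\<lambda>a. 1 - fps_const a * fps_X :: real fps"
  let ?G = "homog_gf ({#x, y, u, v#} + R)"
  have xy: "homog_gf ({#x, y#} + R) = ?l u * (?l v * ?G)"
    using homog_gf_add[of v "add_mset u ({#x, y#} + R)"] homog_gf_add[of u "{#x, y#} + R"]
    by (simp add: add_mset_commute)
  have uv: "homog_gf ({#u, v#} + R) = ?l x * (?l y * ?G)"
    using homog_gf_add[of y "add_mset x ({#u, v#} + R)"] homog_gf_add[of x "{#u, v#} + R"]
    by (simp add: add_mset_commute)
  have "?l u * ?l v - ?l x * ?l y
      = (fps_const x + fps_const y - (fps_const u + fps_const v)) * fps_X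
        + (fps_const u * fps_const v - fps_const x * fps_const y) * fps_X\<^sup>2"
    by (simp add: algebra_simps power2_eq_square del: fps_const_add fps_const_sub fps_const_mult)
  also have "\<dots> = fps_const (u * v - x * y) * fps_X\<^sup>2"
    using assms by simp
  finally have quad: "?l u * ?l v - ?l x * ?l y = fps_const (u * v - x * y) * fps_X\<^sup>2" .
  have "homog_gf ({#x, y#} + R) - homog_gf ({#u, v#} + R) = (?l u * ?l v - ?l x * ?l y) * ?G"
    by (simp only: xy uv left_diff_distrib mult.assoc)
  also have "\<dots> = fps_const (u * v - x * y) * (fps_X\<^sup>2 * ?G)"
    by (simp only: quad mult.assoc)
  finally have "homog_gf ({#x, y#} + R) - homog_gf ({#u, v#} + R) = fps_const (u * v - x * y) * (fps_X\<^sup>2 * ?G)" .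
  from arg_cong[OF this, of "\<lambda>f. fps_nth f (Suc (Suc d))"] show ?thesis
    by (simp add: homog_def fps_X_power_mult_nth)
qed

section \<open>Positivity in even degree\<close>

text \<open>
  As a polynomial in \<open>x\<close>, this is the coefficient of \<open>t\<^sup>d\<close> in
  \<open>exp (x t) * (\<Prod>a\<in>#M. 1 / (1 - a t))\<close>. The exponential factor adds a variable in which one can
  differentiate: differentiation lowers \<open>d\<close> by one, and the value at 0 is \<open>homog M d\<close>.
\<close>

definition appell :: "real multiset \<Rightarrow> nat \<Rightarrow> real poly" where
  "appell M d = (\<Sum>j\<le>d. monom (homog M (d - j) / fact j) j)"

lemma coeff_appell: "coeff (appell M d) j = (if j \<le> d then homog M (d - j) / fact j else 0)"
  by (simp add: appell_def coeff_sum coeff_monom)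

lemma appell_at_0: "poly (appell M d) 0 = homog M d"
  by (simp add: poly_0_coeff_0 coeff_appell)

lemma degree_appell: "degree (appell M d) = d"
  by (intro antisym degree_le le_degree) (simp_all add: coeff_appell)

lemma pderiv_appell: "pderiv (appell M (Suc d)) = appell M d"
  by (intro poly_eqI) (auto simp: coeff_pderiv coeff_appell simp del: of_nat_Suc)

lemma appell_add:
  "appell (add_mset a M) (Suc d) = appell M (Suc d) + smult a (appell (add_mset a M) d)"
  by (intro poly_eqI)
    (auto simp: coeff_appell Suc_diff_le homog_add_Suc field_simps le_Suc_eq)

lemma appell_zeros:
  assumes "\<forall>a\<in>#M. a = 0"
  shows "poly (appell M d) x = x ^ d / fact d"
proof -
  have h: "homog M e = (if e = 0 then 1 else 0)" for e
    using assms
  proof (induction M)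
    case (add a M)
    then show ?case by (cases e) (simp_all add: homog_add_Suc)
  qed (simp add: homog_empty)
  have "appell M d = monom (1 / fact d) d"
    by (intro poly_eqI) (auto simp: coeff_appell h)
  then show ?thesis by (simp add: poly_monom)
qed

text \<open>
  Far out on either side the polynomial exceeds its value at 0, so a minimum over a large interval
  around 0 is a global one.
\<close>

lemma poly_even_degree_attains_min:
  fixes p :: "real poly"
  assumes "even (degree p)" "0 < degree p" "0 < lead_coeff p"
  obtains x where "\<And>y. poly p x \<le> poly p y"
proof -
  \<comment> \<open>The lower bound by the leading coefficient near infinity is applied to \<open>p - p(0)\<close>, so that it compares \<open>p\<close> with \<open>p(0)\<close>; the reflection of this polynomial covers the negative axis.\<close>
  let ?q = "p - [:poly p 0:]"
  have dq: "degree ?q = degree p"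
    using assms(2) by (simp add: degree_add_eq_left flip: add_uminus_conv_diff)
  then have lq: "lead_coeff ?q = lead_coeff p"
    using assms(2) by (cases "degree p") auto
  let ?r = "?q \<circ>\<^sub>p [:0, -1:]"
  have lr: "lead_coeff ?r = lead_coeff p"
    using assms(1) lead_coeff_comp[of "[:0, -1:]" ?q] dq lq by simp
  obtain a where a: "\<forall>x\<ge>a. poly ?q x \<ge> lead_coeff ?q"
    using poly_pinfty_gt_lc[of ?q] lq assms(3) by auto
  obtain b where b: "\<forall>x\<ge>b. poly ?r x \<ge> lead_coeff ?r"
    using poly_pinfty_gt_lc[of ?r] lr assms(3) by auto
  define c where "c = max 0 (max a b)"
  have out: "poly p 0 \<le> poly p y" if "\<not> (-c \<le> y \<and> y \<le> c)" for y
  proof (cases "y \<ge> a")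
    case True
    then show ?thesis using a lq assms(3) by force
  next
    case False
    then have "-y \<ge> b" using that by (auto simp: c_def)
    then have "poly ?r (-y) \<ge> lead_coeff ?r" using b by blast
    then show ?thesis using assms(3) unfolding lr by (simp add: poly_pcompose)
  qed
  have "-c \<le> c" by (simp add: c_def)
  then obtain x where "-c \<le> x" "x \<le> c" and x: "\<And>y. -c \<le> y \<and> y \<le> c \<Longrightarrow> poly p x \<le> poly p y"
    using isCont_eq_Lb[of "-c" c "poly p"] by auto
  moreover have "poly p x \<le> poly p 0" using x by (simp add: c_def)
  ultimately have "poly p x \<le> poly p y" for y
    using out[of y] order_trans by blast
  then show ?thesis using that by blast
qed

text \<open>
  Let \<open>g\<close> be the polynomial of the larger multiset and \<open>f\<close> that of \<open>M\<close>. By \<open>appell_add\<close> and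
  \<open>pderiv_appell\<close>, \<open>g - a g' = f\<close>. At a minimum of \<open>g\<close> the derivative vanishes, so the minimum of
  \<open>g\<close> is a value of \<open>f\<close>.
\<close>

lemma appell_min_step:
  assumes "even d" "0 < d"
  obtains x where "\<And>y. poly (appell (add_mset a M) d) x \<le> poly (appell (add_mset a M) d) y"
    and "poly (appell (add_mset a M) d) x = poly (appell M d) x"
proof -
  let ?p = "appell (add_mset a M) d"
  obtain x where x: "\<And>y. poly ?p x \<le> poly ?p y"
    by (rule poly_even_degree_attains_min[of ?p])
      (use assms in \<open>auto simp: degree_appell coeff_appell\<close>)
  obtain e where e: "d = Suc e" using assms(2) by (cases d) auto
  have "poly (pderiv ?p) x = 0"
    by (rule DERIV_local_min[OF poly_DERIV, of 1]) (use x in auto)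
  then have "poly ?p x = poly (appell M d) x"
    unfolding e pderiv_appell by (simp add: appell_add)
  with x that show ?thesis by blast
qed

text \<open>
  By \<open>appell_min_step\<close> adding an element preserves positivity on the whole line. The induction must
  start from multisets of zeros, where the polynomial is \<open>x ^ d / fact d\<close> and vanishes at 0. Adding
  the first nonzero \<open>a\<close> removes this zero: the new polynomial has the value \<open>a ^ d\<close> at 0, which
  would have to be 0 if its minimum were attained there.
\<close>

lemma appell_pos:
  assumes "even d" "\<exists>a\<in>#M. a \<noteq> 0"
  shows "0 < poly (appell M d) y"
proof (cases "d = 0")
  case True
  then show ?thesis by (simp add: appell_def poly_monom)
next
  case False
  show ?thesis
    using assms(2)
  proof (induction M arbitrary: y)
    case (add a M)
    obtain x where x: "\<And>y. poly (appell (add_mset a M) d) x \<le> poly (appell (add_mset a M) d) y"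
        and eq: "poly (appell (add_mset a M) d) x = poly (appell M d) x"
      using appell_min_step[of d a M] assms False by (metis neq0_conv)
    have "0 < poly (appell M d) x"
    proof (cases "\<exists>b\<in>#M. b \<noteq> 0")
      case True
      then show ?thesis by (rule add.IH)
    next
      case z: False
      then have M0: "\<forall>b\<in>#M. b = 0" and a: "a \<noteq> 0" using add.prems by auto
      have "x \<noteq> 0"
      proof
        assume "x = 0"
        have "homog (add_mset a M) e = a ^ e" for e
        proof (induction e)
          case (Suc e)
          have "homog M (Suc e) = 0"
            using appell_zeros[OF M0, of "Suc e" 0] by (simp add: appell_at_0)
          then show ?case using Suc by (simp add: homog_add_Suc)
        qed simp
        then have "a ^ d = 0"
          using eq False \<open>x = 0\<close> appell_zeros[OF M0, of d 0] by (simp add: appell_at_0)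
        then show False using a by simp
      qed
      then show ?thesis
        using assms(1) by (simp add: appell_zeros[OF M0] zero_less_power_eq)
    qed
    then show ?case using x eq by (metis less_le_trans)
  qed simp
qed

lemma homog_even_pos:
  assumes "even d" "\<exists>a\<in>#M. a \<noteq> 0"
  shows "0 < homog M d"
  using appell_pos[OF assms, of 0] by (simp add: appell_at_0)

section \<open>Minimality at equal arguments\<close>

lemma sum_deviations_balanced:
  fixes M :: "real multiset"
  assumes "(\<Sum>x\<in>#M. x - \<mu>) = 0" and "\<exists>x\<in>#M. x \<noteq> \<mu>"
  shows "\<exists>x\<in>#M. x < \<mu>" and "\<exists>x\<in>#M. \<mu> < x"
proof -
  have pos: "0 < (\<Sum>x\<in>#M. f x)" if nn: "\<forall>x\<in>#M. 0 \<le> f x" and nz: "\<exists>x\<in>#M. f x \<noteq> 0"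
    for f :: "real \<Rightarrow> real"
  proof -
    obtain a N where N: "M = add_mset a N" and a: "f a \<noteq> 0"
      using nz by (metis multi_member_split)
    have "\<forall>x\<in>#N. 0 \<le> f x" using nn N by simp
    then have "0 \<le> (\<Sum>x\<in>#N. f x)" by (induction N) auto
    moreover have "0 < f a" using nn N a by (simp add: less_le)
    ultimately show ?thesis using N by simp
  qed
  show "\<exists>x\<in>#M. x < \<mu>"
  proof (rule ccontr)
    assume "\<not> ?thesis"
    then have "0 < (\<Sum>x\<in>#M. x - \<mu>)" using assms(2) by (intro pos) (auto simp: not_less)
    then show False using assms(1) by simp
  qed
  have "(\<Sum>x\<in>#M. \<mu> - x) = - (\<Sum>x\<in>#M. x - \<mu>)"
    by (induction M) auto
  then have zero: "(\<Sum>x\<in>#M. \<mu> - x) = 0" using assms(1) by simp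
  show "\<exists>x\<in>#M. \<mu> < x"
  proof (rule ccontr)
    assume "\<not> ?thesis"
    then have "0 < (\<Sum>x\<in>#M. \<mu> - x)" using assms(2) by (intro pos) (auto simp: not_less)
    then show False using zero by simp
  qed
qed

text \<open>
  If the elements are not all equal to their mean \<open>\<mu>\<close>, there are \<open>x < \<mu> < y\<close> among them. Replacing
  the pair \<open>x, y\<close> by \<open>\<mu>, x + y - \<mu>\<close> keeps the sum and strictly decreases \<open>homog\<close>: by
  \<open>homog_smoothing\<close> the change is \<open>(\<mu> - x) * (y - \<mu>)\<close> times a value of even degree, which is
  positive by \<open>homog_even_pos\<close>. The number of elements different from \<open>\<mu>\<close> drops, so finitely many
  replacements reach the constant multiset.
\<close>

lemma homog_less_of_not_constant:
  assumes "even d" "2 \<le> d" and "sum_mset M = real (size M) * \<mu>" and "\<exists>x\<in>#M. x \<noteq> \<mu>"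
  shows "homog (replicate_mset (size M) \<mu>) d < homog M d"
  using assms(3,4)
proof (induction "size (filter_mset (\<lambda>x. x \<noteq> \<mu>) M)" arbitrary: M rule: less_induct)
  case less
  have "(\<Sum>x\<in>#M. x - \<mu>) = sum_mset M - real (size M) * \<mu>"
    by (induction M) (auto simp: algebra_simps)
  then have "(\<Sum>x\<in>#M. x - \<mu>) = 0" using less.prems(1) by simp
  from sum_deviations_balanced[OF this less.prems(2)]
  obtain x y where xy: "x \<in># M" "x < \<mu>" "y \<in># M" "\<mu> < y" by blast
  define R where "R = M - {#x, y#}"
  have M: "M = {#x, y#} + R"
    using xy by (auto simp: R_def multiset_eq_iff)
  define v where "v = x + y - \<mu>"
  define N where "N = {#\<mu>, v#} + R"
  obtain e where e: "d = Suc (Suc e)" "even e"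
    using assms(1,2) by (metis add_2_eq_Suc even_add even_numeral le_iff_add)
  have "homog M d - homog N d = (\<mu> * v - x * y) * homog ({#x, y, \<mu>, v#} + R) e"
    unfolding M N_def e(1) by (rule homog_smoothing) (simp add: v_def)
  moreover have "\<mu> * v - x * y = (\<mu> - x) * (y - \<mu>)"
    by (simp add: v_def algebra_simps)
  moreover have "0 < homog ({#x, y, \<mu>, v#} + R) e"
    by (rule homog_even_pos[OF e(2)]) (use xy in auto)
  ultimately have *: "homog N d < homog M d"
    using xy by (metis diff_gt_0_iff_gt mult_pos_pos)
  have size: "size N = size M" by (simp add: M N_def)
  show ?case
  proof (cases "\<exists>x\<in>#N. x \<noteq> \<mu>")
    case True
    moreover have "size (filter_mset (\<lambda>x. x \<noteq> \<mu>) N) < size (filter_mset (\<lambda>x. x \<noteq> \<mu>) M)"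
      using xy by (simp add: M N_def)
    moreover have "sum_mset N = real (size N) * \<mu>"
      using less.prems(1) size by (simp add: M N_def v_def)
    ultimately show ?thesis using less.hyps[of N] * size by simp
  next
    case False
    then have "N = replicate_mset (size N) \<mu>"
      by (metis set_mset_subset_singletonD singletonI subsetI)
    with * size show ?thesis by simp
  qed
qed

section \<open>The cycle index and Newton's recurrence\<close>

text \<open>
  The cycle index of the symmetric group on \<open>d\<close> points, with the indeterminates replaced by the
  values of \<open>p\<close>.
\<close>

definition cycle_sum :: "(nat \<Rightarrow> 'a :: field_char_0) \<Rightarrow> nat \<Rightarrow> 'a" where
  "cycle_sum p d = (\<Sum>\<pi>\<in>partitions d. (\<Prod>k\<leftarrow>\<pi>. p k) / of_nat (z_part \<pi>))"

text \<open>
  Partitions as multisets, in which adding or removing a part needs no reordering.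
\<close>

definition mpartitions :: "nat \<Rightarrow> nat multiset set" where
  "mpartitions d = {M. sum_mset M = d \<and> 0 \<notin># M}"

definition z_mset :: "nat multiset \<Rightarrow> nat" where
  "z_mset M = (\<Prod>i\<in>set_mset M. i ^ count M i * fact (count M i))"

lemma bij_betw_mset_partitions: "bij_betw mset (partitions d) (mpartitions d)"
proof (rule bij_betw_byWitness[where f' = "\<lambda>M. rev (sorted_list_of_multiset M)"])
  show "\<forall>p\<in>partitions d. rev (sorted_list_of_multiset (mset p)) = p"
  proof
    fix p assume "p \<in> partitions d"
    then have "sorted (rev p)" by (simp add: partitions_def sorted_wrt_rev)
    then have "sort p = rev p" by (intro properties_for_sort) auto
    then show "rev (sorted_list_of_multiset (mset p)) = p" by simp
  qed
  show "mset ` partitions d \<subseteq> mpartitions d"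
    by (force simp: partitions_def mpartitions_def sum_mset_sum_list)
  show "(\<lambda>M. rev (sorted_list_of_multiset M)) ` mpartitions d \<subseteq> partitions d"
  proof safe
    fix M assume M: "M \<in> mpartitions d"
    have "sum_list (sorted_list_of_multiset M) = sum_mset M"
      by (metis mset_sorted_list_of_multiset sum_mset_sum_list)
    with M show "rev (sorted_list_of_multiset M) \<in> partitions d"
      by (auto simp: partitions_def mpartitions_def sorted_wrt_rev Suc_le_eq intro: gr0I)
  qed
qed auto

lemma z_part_eq_z_mset: "z_part \<pi> = z_mset (mset \<pi>)"
  by (simp add: z_part_def z_mset_def count_mset)

lemma cycle_sum_mset:
  "cycle_sum p d = (\<Sum>M\<in>mpartitions d. (\<Prod>k\<in>#M. p k) / of_nat (z_mset M))"
  unfolding cycle_sum_def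
  by (subst sum.reindex_bij_betw[OF bij_betw_mset_partitions, symmetric])
    (simp add: z_part_eq_z_mset prod_mset_prod_list flip: mset_map)

lemma z_mset_add: "z_mset (add_mset k N) = k * Suc (count N k) * z_mset N"
proof -
  let ?f = "\<lambda>M i. i ^ count M i * fact (count M i) :: nat"
  have "z_mset (add_mset k N) = ?f (add_mset k N) k * (\<Prod>i\<in>set_mset N - {k}. ?f (add_mset k N) i)"
    by (simp add: z_mset_def prod.insert_remove)
  also have "(\<Prod>i\<in>set_mset N - {k}. ?f (add_mset k N) i) = (\<Prod>i\<in>set_mset N - {k}. ?f N i)"
    by (intro prod.cong) auto
  also have "?f (add_mset k N) k * \<dots> = k * Suc (count N k) * (?f N k * (\<Prod>i\<in>set_mset N - {k}. ?f N i))"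
    by (simp add: algebra_simps)
  also have "?f N k * (\<Prod>i\<in>set_mset N - {k}. ?f N i) = z_mset N"
  proof (cases "k \<in># N")
    case True
    then show ?thesis by (simp add: z_mset_def prod.remove[of "set_mset N" k])
  next
    case False
    then show ?thesis by (simp add: z_mset_def not_in_iff)
  qed
  finally show ?thesis .
qed

lemma z_mset_pos: "0 \<notin># M \<Longrightarrow> 0 < z_mset M"
  by (induction M) (auto simp: z_mset_add z_mset_def)

lemma finite_mpartitions: "finite (mpartitions d)"
  using bij_betw_finite[OF bij_betw_mset_partitions] finite_partitions by blast

lemma sum_mset_multiplicities: "sum_mset M = (\<Sum>k\<in>set_mset M. k * count M k)" for M :: "nat multiset"
proof (induction M)
  case (add a M)
  show ?case
  proof (cases "a \<in># M")
    case True
    then show ?thesis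
      using add by (simp add: sum.remove[of _ a] insert_absorb algebra_simps)
  next
    case False
    then have "(\<Sum>k\<in>set_mset M. k * (if a = k then Suc (count M k) else count M k)) = (\<Sum>k\<in>set_mset M. k * count M k)"
      by (intro sum.cong) auto
    then show ?thesis using add False by (simp add: not_in_iff)
  qed
qed simp

text \<open>
  Write \<open>d\<close> as the sum of \<open>k * count M k\<close> over the distinct parts \<open>k\<close> of a partition \<open>M\<close>, and remove one
  part \<open>k\<close> from \<open>M\<close>. The pairs of a partition of \<open>d\<close> and one of its distinct parts correspond to the
  pairs of a \<open>k\<close> and a partition of \<open>d - k\<close>, and by \<open>z_mset_add\<close> the factor \<open>k * count M k\<close> is
  exactly the quotient of the two values of \<open>z_mset\<close>.
\<close>

lemma newton_cycle_sum: "of_nat d * cycle_sum p d = (\<Sum>k=1..d. p k * cycle_sum p (d - k))"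
proof -
  let ?P = "\<lambda>M. \<Prod>k\<in>#M. p k"
  have "of_nat d * cycle_sum p d
      = (\<Sum>M\<in>mpartitions d. \<Sum>k\<in>set_mset M. of_nat (k * count M k) * (?P M / of_nat (z_mset M)))"
    unfolding cycle_sum_mset sum_distrib_left
  proof (rule sum.cong)
    fix M assume "M \<in> mpartitions d"
    then have "of_nat d = (\<Sum>k\<in>set_mset M. of_nat (k * count M k) :: 'a)"
      using sum_mset_multiplicities[of M] by (simp add: mpartitions_def del: of_nat_mult flip: of_nat_sum)
    then show "of_nat d * (?P M / of_nat (z_mset M))
        = (\<Sum>k\<in>set_mset M. of_nat (k * count M k) * (?P M / of_nat (z_mset M)))"
      by (simp only: sum_distrib_right)
  qed simp
  also have "\<dots> = (\<Sum>(M, k)\<in>Sigma (mpartitions d) set_mset. of_nat (k * count M k) * (?P M / of_nat (z_mset M)))"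
    by (rule sum.Sigma) (simp_all add: finite_mpartitions)
  also have "\<dots> = (\<Sum>(k, N)\<in>(SIGMA k:{1..d}. mpartitions (d - k)). p k * (?P N / of_nat (z_mset N)))"
  proof (rule sum.reindex_bij_witness[of _ "\<lambda>(k, N). (add_mset k N, k)" "\<lambda>(M, k). (k, M - {#k#})"])
    fix x assume "x \<in> Sigma (mpartitions d) set_mset"
    then obtain M k where x: "x = (M, k)" and M: "sum_mset M = d" "0 \<notin># M" and k: "k \<in># M"
      by (auto simp: mpartitions_def)
    obtain N where N: "M = add_mset k N" using k by (metis multi_member_split)
    show "(case case x of (M, k) \<Rightarrow> (k, M - {#k#}) of (k, N) \<Rightarrow> (add_mset k N, k)) = x"
      using x N by simp
    show "(case x of (M, k) \<Rightarrow> (k, M - {#k#})) \<in> (SIGMA k:{1..d}. mpartitions (d - k))"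
      using x N M by (auto simp: mpartitions_def)
    have "of_nat k \<noteq> (0 :: 'a)" "of_nat (Suc (count N k)) \<noteq> (0 :: 'a)" "of_nat (z_mset N) \<noteq> (0 :: 'a)"
      using M N z_mset_pos[of N] by (auto simp del: of_nat_Suc)
    then show "(case case x of (M, k) \<Rightarrow> (k, M - {#k#}) of (k, N) \<Rightarrow> p k * (?P N / of_nat (z_mset N)))
        = (case x of (M, k) \<Rightarrow> of_nat (k * count M k) * (?P M / of_nat (z_mset M)))"
      unfolding x N by (simp add: z_mset_add divide_simps del: of_nat_Suc mult_Suc_right)
  next
    fix y assume "y \<in> (SIGMA k:{1..d}. mpartitions (d - k))"
    then obtain k N where y: "y = (k, N)" "1 \<le> k" "k \<le> d" "sum_mset N = d - k" "0 \<notin># N"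
      by (auto simp: mpartitions_def)
    then show "(case case y of (k, N) \<Rightarrow> (add_mset k N, k) of (M, k) \<Rightarrow> (k, M - {#k#})) = y"
      "(case y of (k, N) \<Rightarrow> (add_mset k N, k)) \<in> Sigma (mpartitions d) set_mset"
      by (auto simp: mpartitions_def)
  qed
  also have "\<dots> = (\<Sum>k=1..d. \<Sum>N\<in>mpartitions (d - k). p k * (?P N / of_nat (z_mset N)))"
    by (rule sum.Sigma[symmetric]) (simp_all add: finite_mpartitions)
  also have "\<dots> = (\<Sum>k=1..d. p k * cycle_sum p (d - k))"
    by (simp only: cycle_sum_mset sum_distrib_left)
  finally show ?thesis .
qed

lemma cycle_sum_0: "cycle_sum p 0 = 1"
proof -
  have "mpartitions 0 = {{#}}"
    by (auto simp: mpartitions_def) (metis multiset_nonemptyE)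
  then show ?thesis by (simp add: cycle_sum_mset z_mset_def)
qed

text \<open>
  Both sides satisfy Newton's recurrence with the same power sums: this is the expansion of complete
  homogeneous symmetric polynomials in power sums.
\<close>

lemma cycle_sum_power_sums:
  assumes "\<And>k. 1 \<le> k \<Longrightarrow> p k = of_real (\<Sum>x\<in>#M. x ^ k)"
  shows "cycle_sum p d = (of_real (homog M d) :: 'a :: {real_div_algebra, field_char_0})"
proof (induction d rule: less_induct)
  case (less d)
  show ?case
  proof (cases "d = 0")
    case False
    have "of_nat d * cycle_sum p d = (\<Sum>k=1..d. p k * cycle_sum p (d - k))"
      by (rule newton_cycle_sum)
    also have "\<dots> = of_real (\<Sum>k=1..d. (\<Sum>x\<in>#M. x ^ k) * homog M (d - k))"
      unfolding of_real_sum of_real_mult using assms less by (intro sum.cong) auto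
    also have "\<dots> = of_nat d * of_real (homog M d)"
      by (simp only: newton_homog[symmetric] of_real_mult of_real_of_nat_eq)
    finally show ?thesis using False by simp
  qed (simp add: cycle_sum_0)
qed

section \<open>Power traces of Hermitian matrices\<close>

lemma mat_trace_mult_commute:
  fixes A B :: "'a :: comm_semiring_0 mat"
  assumes "A \<in> carrier_mat n n" "B \<in> carrier_mat n n"
  shows "mat_trace (A * B) = mat_trace (B * A)"
proof -
  have "mat_trace (A * B) = (\<Sum>i<n. \<Sum>j<n. A $$ (i, j) * B $$ (j, i))"
    using assms by (simp add: mat_trace_def scalar_prod_def atLeast0LessThan)
  also have "\<dots> = (\<Sum>j<n. \<Sum>i<n. B $$ (j, i) * A $$ (i, j))"
    by (subst sum.swap) (simp add: mult.commute)
  also have "\<dots> = mat_trace (B * A)"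
    using assms by (simp add: mat_trace_def scalar_prod_def atLeast0LessThan)
  finally show ?thesis .
qed

lemma upper_triangular_pow:
  fixes B :: "'a :: comm_semiring_1 mat"
  assumes B: "B \<in> carrier_mat n n" and ut: "upper_triangular B"
  shows "i < n \<Longrightarrow> j < i \<Longrightarrow> (B ^\<^sub>m k) $$ (i, j) = 0"
    and "i < n \<Longrightarrow> (B ^\<^sub>m k) $$ (i, i) = B $$ (i, i) ^ k"
proof -
  have main: "\<forall>i<n. (\<forall>j<i. (B ^\<^sub>m k) $$ (i, j) = 0) \<and> (B ^\<^sub>m k) $$ (i, i) = B $$ (i, i) ^ k"
  proof (induction k)
    case (Suc k)
    have entry: "(B ^\<^sub>m Suc k) $$ (i, j) = (\<Sum>c<n. if c = i \<and> j = i then B $$ (i, i) ^ Suc k else 0)"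
      if ij: "i < n" "j \<le> i" for i j
    proof -
      have "(B ^\<^sub>m Suc k) $$ (i, j) = (\<Sum>c<n. (B ^\<^sub>m k) $$ (i, c) * B $$ (c, j))"
        using B ij by (simp add: scalar_prod_def atLeast0LessThan)
      also have "\<dots> = (\<Sum>c<n. if c = i \<and> j = i then B $$ (i, i) ^ Suc k else 0)"
      proof (rule sum.cong)
        fix c assume c: "c \<in> {..<n}"
        consider "c < i" | "j < c" | "c = i" "j = i" using ij by linarith
        then show "(B ^\<^sub>m k) $$ (i, c) * B $$ (c, j) = (if c = i \<and> j = i then B $$ (i, i) ^ Suc k else 0)"
        proof cases
          case 1
          then show ?thesis using Suc ij by simp
        next
          case 2
          then have "B $$ (c, j) = 0" using B c by (intro upper_triangularD[OF ut]) auto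
          then show ?thesis using 2 by auto
        next
          case 3
          then show ?thesis using Suc ij by (simp add: mult.commute)
        qed
      qed simp
      finally show ?thesis .
    qed
    show ?case by (auto simp: entry simp del: pow_mat.simps)
  qed (use B in auto)
  show "i < n \<Longrightarrow> j < i \<Longrightarrow> (B ^\<^sub>m k) $$ (i, j) = 0"
    and "i < n \<Longrightarrow> (B ^\<^sub>m k) $$ (i, i) = B $$ (i, i) ^ k"
    using main by auto
qed

text \<open>
  The Schur form \<open>B\<close> of \<open>A\<close> is upper triangular with the roots of the characteristic polynomial on
  the diagonal, and the powers of \<open>A\<close> and \<open>B\<close> are similar.
\<close>

lemma mat_trace_pow_eigenvalues:
  fixes A :: "complex mat"
  assumes A: "A \<in> carrier_mat n n"
  obtains es where "length es = n" "\<And>e. e \<in> set es \<Longrightarrow> eigenvalue A e"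
    "\<And>k. mat_trace (A ^\<^sub>m k) = (\<Sum>e\<leftarrow>es. e ^ k)"
proof -
  obtain es where cp: "char_poly A = (\<Prod>a\<leftarrow>es. [:- a, 1:])" and len: "length es = n"
    using char_poly_factorized[OF A] by blast
  obtain B P Q where BPQ: "schur_decomposition A es = (B, P, Q)" by (metis prod_cases3)
  from schur_decomposition[OF A cp BPQ] have sim: "similar_mat_wit A B P Q"
    and ut: "upper_triangular B" and diag: "diag_mat B = es" by auto
  from similar_mat_witD2[OF A sim] have c: "B \<in> carrier_mat n n" "P \<in> carrier_mat n n"
    "Q \<in> carrier_mat n n" and QP: "Q * P = 1\<^sub>m n" by auto
  have "mat_trace (A ^\<^sub>m k) = (\<Sum>e\<leftarrow>es. e ^ k)" for k
  proof -
    let ?D = "B ^\<^sub>m k"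
    have D: "?D \<in> carrier_mat n n" using c by simp
    have "mat_trace (A ^\<^sub>m k) = mat_trace (P * ?D * Q)"
      using similar_mat_wit_pow_id[OF sim] by simp
    also have "\<dots> = mat_trace (Q * (P * ?D))"
      by (rule mat_trace_mult_commute[of _ n]) (use c D in auto)
    also have "Q * (P * ?D) = ?D"
      using c D QP by (simp flip: assoc_mult_mat[of Q n n P n ?D n])
    also have "mat_trace ?D = (\<Sum>i<n. B $$ (i, i) ^ k)"
      unfolding mat_trace_def using c D upper_triangular_pow(2)[OF c(1) ut] by simp
    also have "\<dots> = (\<Sum>e\<leftarrow>diag_mat B. e ^ k)"
      using c by (simp add: diag_mat_def comp_def interv_sum_list_conv_sum_set_nat atLeast0LessThan)
    finally show ?thesis by (simp add: diag)
  qed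
  moreover have "eigenvalue A e" if "e \<in> set es" for e
    unfolding eigenvalue_root_char_poly[OF A] cp using that
    by (induction es) auto
  ultimately show ?thesis using that len by blast
qed

lemma hermitian_entry:
  fixes A :: "complex mat"
  assumes "A \<in> carrier_mat n n" "mat_adjoint A = A" "i < n" "j < n"
  shows "cnj (A $$ (i, j)) = A $$ (j, i)"
  using mat_adjoint_index[OF assms(1,4,3)] assms(2) by simp

text \<open>
  For an eigenvector \<open>v\<close> the form \<open>v\<^sup>* A v\<close> equals \<open>e\<close> times the squared norm of \<open>v\<close>, and it equals its
  own conjugate.
\<close>

lemma hermitian_eigenvalue_real:
  fixes A :: "complex mat"
  assumes A: "A \<in> carrier_mat n n" and herm: "mat_adjoint A = A" and ev: "eigenvalue A e"
  shows "e \<in> \<real>"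
proof -
  obtain v where v: "v \<in> carrier_vec n" "v \<noteq> 0\<^sub>v n" and Av: "A *\<^sub>v v = e \<cdot>\<^sub>v v"
    using ev A by (auto simp: eigenvalue_def eigenvector_def)
  have row: "(\<Sum>j<n. A $$ (i, j) * v $ j) = e * v $ i" if "i < n" for i
    using arg_cong[OF Av, of "\<lambda>u. u $ i"] that A v by (simp add: scalar_prod_def atLeast0LessThan)
  define N where "N = (\<Sum>i<n. (cmod (v $ i))\<^sup>2)"
  define q where "q = (\<Sum>i<n. \<Sum>j<n. cnj (v $ i) * A $$ (i, j) * v $ j)"
  have "q = (\<Sum>i<n. cnj (v $ i) * (e * v $ i))"
    unfolding q_def using row by (intro sum.cong) (simp_all flip: sum_distrib_left add: mult.assoc)
  also have "\<dots> = e * of_real N"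
    unfolding N_def of_real_sum sum_distrib_left
    by (intro sum.cong) (simp_all only: complex_norm_square ac_simps)
  finally have q: "q = e * of_real N" .
  have "cnj q = (\<Sum>i<n. \<Sum>j<n. cnj (v $ j) * A $$ (j, i) * v $ i)"
    unfolding q_def cnj_sum
    by (intro sum.cong refl) (simp add: hermitian_entry[OF A herm] mult.commute mult.left_commute)
  also have "\<dots> = q"
    unfolding q_def by (rule sum.swap)
  finally have "cnj q = q" .
  then have eq: "cnj e * of_real N = e * of_real N" by (simp add: q)
  obtain i where "i < n" "v $ i \<noteq> 0"
    using v by (metis carrier_vecD eq_vecI index_zero_vec)
  then have "N \<noteq> 0"
    unfolding N_def by (subst sum_nonneg_eq_0_iff) auto
  then show ?thesis using eq by (simp add: Reals_cnj_iff)
qed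

lemma hermitian_spectrum:
  fixes A :: "complex mat"
  assumes A: "A \<in> carrier_mat n n" and herm: "mat_adjoint A = A"
  obtains M :: "real multiset" where "size M = n"
    "\<And>k. mat_trace (A ^\<^sub>m k) = of_real (\<Sum>x\<in>#M. x ^ k)"
proof -
  obtain es where es: "length es = n" "\<And>e. e \<in> set es \<Longrightarrow> eigenvalue A e"
    "\<And>k. mat_trace (A ^\<^sub>m k) = (\<Sum>e\<leftarrow>es. e ^ k)"
    using mat_trace_pow_eigenvalues[OF A] by blast
  have "\<forall>e\<in>set es. e \<in> \<real>"
    using es(2) hermitian_eigenvalue_real[OF A herm] by blast
  then have "(\<Sum>e\<leftarrow>es. e ^ k) = of_real (\<Sum>x\<in>#mset (map Re es). x ^ k)" for k
    by (induction es) auto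
  then show ?thesis
    using that[of "mset (map Re es)"] es by simp
qed

text \<open>
  The two traces are those of the scalar matrix, and for Hermitian \<open>A\<close> they say that
  \<open>tr ((A - \<mu> 1)\<^sup>2)\<close>, the squared Frobenius norm of \<open>A - \<mu> 1\<close>, is 0. So a Hermitian
  matrix with a single eigenvalue is seen to be scalar without a unitary diagonalization.
\<close>

lemma hermitian_scalar_of_traces:
  fixes A :: "complex mat"
  assumes A: "A \<in> carrier_mat n n" and herm: "mat_adjoint A = A"
    and tr: "mat_trace A = of_nat n * of_real \<mu>" and tr2: "mat_trace (A * A) = of_nat n * of_real (\<mu>\<^sup>2)"
  shows "A = of_real \<mu> \<cdot>\<^sub>m 1\<^sub>m n"
proof -
  let ?D = "\<lambda>i j. (if i = j then of_real \<mu> else 0 :: complex)"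
  have "of_real (\<Sum>i<n. \<Sum>j<n. (cmod (A $$ (i, j) - ?D i j))\<^sup>2)
      = (\<Sum>i<n. \<Sum>j<n. (A $$ (i, j) - ?D i j) * (A $$ (j, i) - ?D i j))"
    unfolding of_real_sum complex_norm_square
    by (intro sum.cong refl) (simp add: hermitian_entry[OF A herm])
  also have "\<dots> = (\<Sum>i<n. \<Sum>j<n. A $$ (i, j) * A $$ (j, i)
      + (if i = j then of_real \<mu> * of_real \<mu> - 2 * of_real \<mu> * A $$ (i, i) else 0))"
    by (intro sum.cong) (auto simp: algebra_simps)
  also have "\<dots> = mat_trace (A * A) + of_nat n * of_real (\<mu>\<^sup>2) - 2 * of_real \<mu> * mat_trace A"
    using A by (simp add: mat_trace_def scalar_prod_def atLeast0LessThan sum.distrib sum_subtractf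
        sum_distrib_left power2_eq_square)
  also have "\<dots> = 0" by (simp add: tr tr2 power2_eq_square)
  finally have "(\<Sum>i<n. \<Sum>j<n. (cmod (A $$ (i, j) - ?D i j))\<^sup>2) = 0"
    by (simp only: of_real_eq_0_iff)
  then have "A $$ (i, j) = ?D i j" if "i < n" "j < n" for i j
    using that by (subst (asm) sum_nonneg_eq_0_iff) (auto simp: sum_nonneg sum_nonneg_eq_0_iff)
  then show ?thesis using A by (intro eq_matI) auto
qed

lemma mat_trace_scalar_pow: "mat_trace ((c \<cdot>\<^sub>m 1\<^sub>m n) ^\<^sub>m k) = of_nat n * c ^ k" for c :: complex
proof -
  have "(c \<cdot>\<^sub>m 1\<^sub>m n) ^\<^sub>m k = c ^ k \<cdot>\<^sub>m 1\<^sub>m n"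
  proof (induction k)
    case (Suc k)
    have "(c \<cdot>\<^sub>m 1\<^sub>m n) ^\<^sub>m Suc k = (c ^ k \<cdot>\<^sub>m 1\<^sub>m n) * (c \<cdot>\<^sub>m 1\<^sub>m n)" by (simp add: Suc)
    also have "\<dots> = c ^ Suc k \<cdot>\<^sub>m 1\<^sub>m n"
      by (intro eq_matI) (auto simp: scalar_prod_def if_distrib cong: if_cong)
    finally show ?case .
  qed auto
  then show ?thesis by (simp add: mat_trace_def)
qed

abbreviation cycle_trace :: "complex mat \<Rightarrow> nat \<Rightarrow> complex" where
  "cycle_trace B d \<equiv> cycle_sum (\<lambda>k. mat_trace (B ^\<^sub>m k)) d"

text \<open>
  The theorem for Hermitian matrices, before taking roots: by \<open>cycle_sum_power_sums\<close> the left-hand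
  side is \<open>homog\<close> of the multiset of eigenvalues, which is smallest exactly when all of them equal their mean
  \<open>t / n\<close>.
\<close>

lemma hermitian_cycle_trace:
  assumes B: "B \<in> carrier_mat n n" and herm: "mat_adjoint B = B"
    and n: "1 \<le> n" and d: "even d" "2 \<le> d" and tr: "mat_trace B = of_real t"
  defines "c \<equiv> real ((n + d - 1) choose d)"
  obtains h where "cycle_trace B d = of_real h" "c * (t / n) ^ d \<le> h"
    "h = c * (t / n) ^ d \<longleftrightarrow> (\<exists>a. B = a \<cdot>\<^sub>m 1\<^sub>m n)"
proof -
  obtain M where size: "size M = n" and M: "\<And>k. mat_trace (B ^\<^sub>m k) = of_real (\<Sum>x\<in>#M. x ^ k)"
    using hermitian_spectrum[OF B herm] by blast
  have pow: "B ^\<^sub>m 1 = B" "B ^\<^sub>m 2 = B * B"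
    using B by (simp_all add: numeral_2_eq_2)
  let ?\<mu> = "t / n" and ?R = "replicate_mset n (t / n)"
  have "complex_of_real (sum_mset M) = of_real t"
    using M[of 1] by (simp add: pow tr)
  then have "sum_mset M = t" by (simp only: of_real_eq_iff)
  then have sum: "sum_mset M = real (size M) * ?\<mu>"
    using n by (simp add: size)
  have R: "homog ?R d = c * ?\<mu> ^ d"
    using homog_replicate[OF n] by (simp add: c_def)
  have h: "cycle_trace B d = of_real (homog M d)"
    by (intro cycle_sum_power_sums M)
  have const: "M = ?R" if "\<not> (\<exists>x\<in>#M. x \<noteq> ?\<mu>)"
    using that size by (metis set_mset_subset_singletonD singletonI subsetI)
  have less: "homog ?R d < homog M d" if "\<exists>x\<in>#M. x \<noteq> ?\<mu>"
    using homog_less_of_not_constant[OF d sum that] by (simp add: size)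
  have "homog M d = c * ?\<mu> ^ d \<longleftrightarrow> (\<exists>a. B = a \<cdot>\<^sub>m 1\<^sub>m n)"
  proof
    assume "homog M d = c * ?\<mu> ^ d"
    then have "M = ?R" using less const R by force
    then have "mat_trace B = of_nat n * of_real ?\<mu>" "mat_trace (B * B) = of_nat n * of_real (?\<mu>\<^sup>2)"
      using M[of 1] M[of 2] by (simp_all add: pow)
    then show "\<exists>a. B = a \<cdot>\<^sub>m 1\<^sub>m n" using hermitian_scalar_of_traces[OF B herm] by blast
  next
    assume "\<exists>a. B = a \<cdot>\<^sub>m 1\<^sub>m n"
    then obtain a where a: "B = a \<cdot>\<^sub>m 1\<^sub>m n" by blast
    have "of_nat n * a = of_real t"
      using mat_trace_scalar_pow[of a n 1] tr pow by (simp add: a)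
    then have "a = of_real ?\<mu>" using n by (simp add: field_simps)
    then have "mat_trace (B ^\<^sub>m k) = of_real (\<Sum>x\<in>#?R. x ^ k)" for k
      using mat_trace_scalar_pow[of a n k] by (simp add: a)
    then have "cycle_trace B d = of_real (homog ?R d)"
      by (intro cycle_sum_power_sums)
    then show "homog M d = c * ?\<mu> ^ d" by (simp only: h R of_real_eq_iff)
  qed
  moreover have "c * ?\<mu> ^ d \<le> homog M d"
    using less const R by (metis less_imp_le order_refl)
  ultimately show ?thesis using that h by blast
qed

section \<open>Expansion into words in a matrix and its adjoint\<close>

text \<open>
  The word read by \<open>block_word\<close> in a single block, with the replaced positions given as a set of
  numbers.
\<close>

definition word :: "complex mat \<Rightarrow> nat set \<Rightarrow> nat \<Rightarrow> complex mat" where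
  "word A S k = foldr (*) (map (\<lambda>i. if i \<in> S then mat_adjoint A else A) [0..<k]) (1\<^sub>m (dim_row A))"

lemma block_word_eq_word: "block_word A S j k = word A {i. (j, i) \<in> S} k"
  by (simp add: block_word_def word_def)

lemma word_cong: "S \<inter> {..<k} = S' \<inter> {..<k} \<Longrightarrow> word A S k = word A S' k"
  unfolding word_def by (intro arg_cong[of _ _ "\<lambda>ws. foldr (*) ws _"] map_cong) auto

lemma word_carrier:
  assumes "A \<in> carrier_mat n n"
  shows "word A S k \<in> carrier_mat n n"
proof -
  have "set (map (\<lambda>i. if i \<in> S then mat_adjoint A else A) [0..<k]) \<subseteq> carrier_mat n n"
    using assms by (auto intro: mat_adjoint_carrier)
  then show ?thesis using foldr_mat_carrier assms by (simp add: word_def)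
qed

lemma word_Suc:
  assumes "A \<in> carrier_mat n n"
  shows "word A S (Suc k) = word A S k * (if k \<in> S then mat_adjoint A else A)"
proof -
  have "set (map (\<lambda>i. if i \<in> S then mat_adjoint A else A) [0..<k]) \<subseteq> carrier_mat n n"
    using assms by (auto intro: mat_adjoint_carrier)
  from foldr_mat_snoc[OF this, of "if k \<in> S then mat_adjoint A else A"] show ?thesis
    using assms mat_adjoint_carrier[OF assms] by (auto simp: word_def)
qed

text \<open>
  Multiplying out the power gives one word for each set \<open>S\<close> of factors from which
  \<open>w \<cdot>\<^sub>m mat_adjoint A\<close> is taken. In the induction a subset of \<open>{..<Suc k}\<close> is \<open>S\<close> or
  \<open>insert k S\<close> with \<open>S \<subseteq> {..<k}\<close>, depending on the last factor.
\<close>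

lemma pow_combination_entry:
  assumes A: "A \<in> carrier_mat n n" and ab: "a < n" "b < n"
  shows "((z \<cdot>\<^sub>m A + w \<cdot>\<^sub>m mat_adjoint A) ^\<^sub>m k) $$ (a, b)
    = (\<Sum>S\<in>Pow {..<k}. z ^ (k - card S) * w ^ card S * word A S k $$ (a, b))"
  using ab(2)
proof (induction k arbitrary: b)
  case 0
  then show ?case using A ab mat_adjoint_carrier[OF A] by (simp add: word_def)
next
  case (Suc k)
  let ?B = "z \<cdot>\<^sub>m A + w \<cdot>\<^sub>m mat_adjoint A" and ?A' = "mat_adjoint A"
  let ?f = "\<lambda>S. z ^ (k - card S) * w ^ card S"
  let ?g = "\<lambda>S. z ^ (Suc k - card S) * w ^ card S * word A S (Suc k) $$ (a, b)"
  have A': "?A' \<in> carrier_mat n n" using mat_adjoint_carrier[OF A] .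
  have B: "?B \<in> carrier_mat n n" using A A' by simp
  have prod: "(X * Y) $$ (a, b) = (\<Sum>c<n. X $$ (a, c) * Y $$ (c, b))"
    if "X \<in> carrier_mat n n" "Y \<in> carrier_mat n n" for X Y :: "complex mat"
    using that ab Suc.prems by (simp add: scalar_prod_def atLeast0LessThan)
  have step: "?g S + ?g (insert k S)
      = (\<Sum>c<n. ?f S * word A S k $$ (a, c) * (z * A $$ (c, b) + w * ?A' $$ (c, b)))"
    if S: "S \<in> Pow {..<k}" for S
  proof -
    have "finite S" "k \<notin> S" "card S \<le> k"
      using S finite_subset[of S "{..<k}"] card_mono[of "{..<k}" S] by auto
    moreover have "word A (insert k S) k = word A S k" by (rule word_cong) auto
    ultimately have "?g S + ?g (insert k S)
        = ?f S * z * (word A S k * A) $$ (a, b) + ?f S * w * (word A S k * ?A') $$ (a, b)"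
      by (simp add: word_Suc[OF A] Suc_diff_le)
    also have "\<dots> = (\<Sum>c<n. ?f S * word A S k $$ (a, c) * (z * A $$ (c, b) + w * ?A' $$ (c, b)))"
      unfolding prod[OF word_carrier[OF A] A] prod[OF word_carrier[OF A] A']
        sum_distrib_left sum.distrib[symmetric]
      by (intro sum.cong) (simp_all add: algebra_simps)
    finally show ?thesis .
  qed
  have "(?B ^\<^sub>m Suc k) $$ (a, b) = (\<Sum>c<n. (?B ^\<^sub>m k) $$ (a, c) * (z * A $$ (c, b) + w * ?A' $$ (c, b)))"
    using prod[of "?B ^\<^sub>m k" ?B] B A A' Suc.prems by simp
  also have "\<dots> = (\<Sum>c<n. \<Sum>S\<in>Pow {..<k}.
      ?f S * word A S k $$ (a, c) * (z * A $$ (c, b) + w * ?A' $$ (c, b)))"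
    by (intro sum.cong) (simp_all add: Suc.IH sum_distrib_right)
  also have "\<dots> = (\<Sum>S\<in>Pow {..<k}. ?g S + ?g (insert k S))"
    by (subst sum.swap, rule sum.cong) (simp_all only: step)
  also have "\<dots> = (\<Sum>S\<in>Pow {..<k} \<union> insert k ` Pow {..<k}. ?g S)"
  proof -
    have "inj_on (insert k) (Pow {..<k})" by (rule inj_onI) (force simp: insert_ident)
    moreover have "Pow {..<k} \<inter> insert k ` Pow {..<k} = {}" by auto
    ultimately show ?thesis
      by (subst sum.union_disjoint) (simp_all add: sum.reindex sum.distrib)
  qed
  also have "Pow {..<k} \<union> insert k ` Pow {..<k} = Pow {..<Suc k}"
    by (simp add: lessThan_Suc Pow_insert)
  finally show ?case .
qed

lemma mat_trace_pow_combination: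
  assumes A: "A \<in> carrier_mat n n"
  shows "mat_trace ((z \<cdot>\<^sub>m A + w \<cdot>\<^sub>m mat_adjoint A) ^\<^sub>m k)
    = (\<Sum>S\<in>Pow {..<k}. z ^ (k - card S) * w ^ card S * mat_trace (word A S k))"
proof -
  have B: "z \<cdot>\<^sub>m A + w \<cdot>\<^sub>m mat_adjoint A \<in> carrier_mat n n"
    using A mat_adjoint_carrier[OF A] by simp
  have "mat_trace ((z \<cdot>\<^sub>m A + w \<cdot>\<^sub>m mat_adjoint A) ^\<^sub>m k)
    = (\<Sum>a<n. \<Sum>S\<in>Pow {..<k}. z ^ (k - card S) * w ^ card S * word A S k $$ (a, a))"
    unfolding mat_trace_def pow_mat_dim_square[OF B]
    by (intro sum.cong refl) (simp add: pow_combination_entry[OF A])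
  also have "\<dots> = (\<Sum>S\<in>Pow {..<k}. z ^ (k - card S) * w ^ card S * mat_trace (word A S k))"
    using carrier_matD(1)[OF word_carrier[OF A]]
    by (subst sum.swap) (simp add: mat_trace_def sum_distrib_left)
  finally show ?thesis .
qed

text \<open>
  A choice of a set in every block is the same as one subset of \<open>positions p\<close>, so the selections that
  define \<open>T_part\<close> are the terms in which \<open>z\<close> and \<open>w\<close> occur equally often.
\<close>

lemma prod_trace_pow_combination:
  assumes A: "A \<in> carrier_mat n n"
  shows "(\<Prod>j<length p. mat_trace ((z \<cdot>\<^sub>m A + w \<cdot>\<^sub>m mat_adjoint A) ^\<^sub>m (p ! j)))
    = (\<Sum>S\<in>Pow (positions p). z ^ (sum_list p - card S) * w ^ card S
        * (\<Prod>j<length p. mat_trace (block_word A S j (p ! j))))"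
proof -
  let ?r = "length p"
  let ?h = "\<lambda>j S. z ^ (p ! j - card S) * w ^ card S * mat_trace (word A S (p ! j))"
  have "(\<Prod>j<?r. mat_trace ((z \<cdot>\<^sub>m A + w \<cdot>\<^sub>m mat_adjoint A) ^\<^sub>m (p ! j)))
      = (\<Prod>j<?r. \<Sum>S\<in>Pow {..<p ! j}. ?h j S)"
    by (simp only: mat_trace_pow_combination[OF A])
  also have "\<dots> = (\<Sum>F\<in>(\<Pi>\<^sub>E j\<in>{..<?r}. Pow {..<p ! j}). \<Prod>j<?r. ?h j (F j))"
    by (rule prod_sum_PiE) auto
  also have "\<dots> = (\<Sum>S\<in>Pow (positions p). z ^ (sum_list p - card S) * w ^ card S
        * (\<Prod>j<?r. mat_trace (block_word A S j (p ! j))))"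
  proof (rule sum.reindex_bij_witness[of _ "\<lambda>S. \<lambda>j\<in>{..<?r}. {i. (j, i) \<in> S}" "\<lambda>F. Sigma {..<?r} F"])
    fix F assume F: "F \<in> (\<Pi>\<^sub>E j\<in>{..<?r}. Pow {..<p ! j})"
    then have Fj: "F j \<subseteq> {..<p ! j}" if "j < ?r" for j using that by auto
    then have fin: "finite (F j)" and le: "card (F j) \<le> p ! j" if "j < ?r" for j
      using that finite_subset[of "F j" "{..<p ! j}"] card_mono[of "{..<p ! j}" "F j"] by auto
    have cardF: "card (Sigma {..<?r} F) = (\<Sum>j<?r. card (F j))"
      using fin by (intro card_SigmaI) auto
    have "sum_list p - card (Sigma {..<?r} F) = (\<Sum>j<?r. p ! j - card (F j))"
      unfolding cardF using le sum_subtractf_nat[of "{..<?r}" "\<lambda>j. card (F j)" "(!) p"]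
      by (simp add: sum_list_sum_nth atLeast0LessThan)
    then show "z ^ (sum_list p - card (Sigma {..<?r} F)) * w ^ card (Sigma {..<?r} F)
        * (\<Prod>j<?r. mat_trace (block_word A (Sigma {..<?r} F) j (p ! j))) = (\<Prod>j<?r. ?h j (F j))"
      by (simp add: cardF power_sum prod.distrib block_word_eq_word)
    show "(\<lambda>j\<in>{..<?r}. {i. (j, i) \<in> Sigma {..<?r} F}) = F"
      using F by (auto simp: fun_eq_iff restrict_def PiE_def extensional_def)
    show "Sigma {..<?r} F \<in> Pow (positions p)"
      using Fj by (auto simp: positions_def)
  next
    fix S assume "S \<in> Pow (positions p)"
    then show "Sigma {..<?r} (\<lambda>j\<in>{..<?r}. {i. (j, i) \<in> S}) = S"
      "(\<lambda>j\<in>{..<?r}. {i. (j, i) \<in> S}) \<in> (\<Pi>\<^sub>E j\<in>{..<?r}. Pow {..<p ! j})"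
      by (auto simp: positions_def)
  qed
  finally show ?thesis .
qed

section \<open>Averaging over roots of unity\<close>

definition unit_root :: "nat \<Rightarrow> nat \<Rightarrow> complex" where
  "unit_root d k = cis (2 * pi * real k / real (Suc d))"

text \<open>
  The summand is the \<open>(d - 2 s)\<close>-th power of a root of unity. Its sum over all \<open>(d + 1)\<close>-th roots of unity
  vanishes unless \<open>d + 1\<close> divides \<open>d - 2 s\<close>. As \<open>\<bar>d - 2 s\<bar> \<le> d\<close>, this leaves only \<open>2 s = d\<close>; with \<open>d\<close>
  instead of \<open>d + 1\<close> roots the extreme terms \<open>s = 0\<close> and \<open>s = d\<close> would survive.
\<close>

lemma sum_unit_root_monomial:
  assumes "s \<le> d"
  shows "(\<Sum>k<Suc d. unit_root d k ^ (d - s) * cnj (unit_root d k) ^ s)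
    = (if 2 * s = d then of_nat (Suc d) else 0)"
proof -
  define t where "t = 2 * pi / real (Suc d)"
  define q where "q = cis ((real d - 2 * real s) * t)"
  have t: "real (Suc d) * t = 2 * pi" by (simp add: t_def)
  have root: "unit_root d k = cis (real k * t)" for k
    by (simp add: unit_root_def t_def mult.commute)
  have "unit_root d k ^ (d - s) * cnj (unit_root d k) ^ s = q ^ k" for k
    using assms by (simp add: root q_def cis_cnj DeMoivre cis_mult of_nat_diff algebra_simps)
  then have sum: "(\<Sum>k<Suc d. unit_root d k ^ (d - s) * cnj (unit_root d k) ^ s) = (\<Sum>k<Suc d. q ^ k)"
    by simp
  show ?thesis
  proof (cases "2 * s = d")
    case True
    then have "real d - 2 * real s = 0" by linarith
    then have "q = 1" by (simp add: q_def)
    then show ?thesis using True sum by simp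
  next
    case False
    have "q ^ Suc d = cis ((real d - 2 * real s) * (real (Suc d) * t))"
      unfolding q_def DeMoivre by (simp only: mult.left_commute)
    also have "\<dots> = 1"
      unfolding t using cis_multiple_2pi[of "real d - 2 * real s"] by (simp add: mult.commute)
    finally have "q ^ Suc d = 1" .
    moreover have "q \<noteq> 1"
    proof
      assume "q = 1"
      then have "cos ((real d - 2 * real s) * t) = 1" by (simp add: q_def complex_eq_iff)
      then obtain m :: int where "(real d - 2 * real s) * t = of_int m * (2 * pi)"
        by (auto simp: cos_one_2pi_int)
      then have "(real d - 2 * real s) * t = of_int m * real (Suc d) * t"
        by (simp only: t[symmetric] mult.assoc)
      moreover have "t \<noteq> 0" using t by auto
      ultimately have "real d - 2 * real s = of_int m * real (Suc d)" by simp
      then have "real_of_int (int d - 2 * int s) = real_of_int (m * int (Suc d))" by simp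
      then have eq: "int d - 2 * int s = m * int (Suc d)" by (simp only: of_int_eq_iff)
      then have "int (Suc d) dvd int d - 2 * int s" by simp
      moreover have "\<bar>int d - 2 * int s\<bar> < int (Suc d)" using assms by linarith
      ultimately have "int d - 2 * int s = 0"
        using dvd_imp_le_int[of "int d - 2 * int s" "int (Suc d)"] by fastforce
      then show False using False by linarith
    qed
    ultimately have "(\<Sum>k<Suc d. q ^ k) = 0" using geometric_sum[of q "Suc d"] by simp
    then show ?thesis using False sum by simp
  qed
qed

text \<open>
  For \<open>cmod z = 1\<close> this is twice the Hermitian part of the rotated matrix \<open>z A\<close>.
\<close>

definition rotated_real_part :: "complex mat \<Rightarrow> complex \<Rightarrow> complex mat" where
  "rotated_real_part A z = z \<cdot>\<^sub>m A + cnj z \<cdot>\<^sub>m mat_adjoint A"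

lemma rotated_real_part:
  assumes A: "A \<in> carrier_mat n n"
  shows "rotated_real_part A z \<in> carrier_mat n n"
    and "mat_adjoint (rotated_real_part A z) = rotated_real_part A z"
    and "mat_trace (rotated_real_part A z) = of_real (2 * Re (z * mat_trace A))"
proof -
  let ?B = "rotated_real_part A z"
  note A' = mat_adjoint_carrier[OF A]
  show B: "?B \<in> carrier_mat n n" using A A' by (simp add: rotated_real_part_def)
  have entry: "?B $$ (i, j) = z * A $$ (i, j) + cnj (z * A $$ (j, i))" if "i < n" "j < n" for i j
    using that A A' by (simp add: rotated_real_part_def mat_adjoint_index[OF A])
  show "mat_adjoint ?B = ?B"
    using mat_adjoint_carrier[OF B] B
    by (intro eq_matI) (auto simp: mat_adjoint_index[OF B] entry)
  have "mat_trace ?B = (\<Sum>i<n. z * A $$ (i, i) + cnj (z * A $$ (i, i)))"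
    using B by (simp add: mat_trace_def entry)
  also have "\<dots> = z * mat_trace A + cnj (z * mat_trace A)"
    using A by (simp add: mat_trace_def sum.distrib sum_distrib_left)
  also have "\<dots> = of_real (2 * Re (z * mat_trace A))" by (rule complex_add_cnj)
  finally show "mat_trace ?B = of_real (2 * Re (z * mat_trace A))" .
qed

lemma rotated_real_part_scalar:
  "rotated_real_part (a \<cdot>\<^sub>m 1\<^sub>m n) z = (z * a + cnj (z * a)) \<cdot>\<^sub>m 1\<^sub>m n"
proof -
  have A: "a \<cdot>\<^sub>m 1\<^sub>m n \<in> carrier_mat n n" by simp
  show ?thesis
    using mat_adjoint_carrier[OF A] unfolding rotated_real_part_def
    by (intro eq_matI) (auto simp: mat_adjoint_index[OF A])
qed

text \<open>
  Used with \<open>f = card\<close> for the selections of positions, and with the identity as \<open>f\<close> for the exponents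
  in the binomial theorem.
\<close>

lemma sum_unit_root_filter:
  assumes "\<forall>S\<in>X. f S \<le> d" and "finite X" and "even d"
  shows "(\<Sum>k<Suc d. \<Sum>S\<in>X. unit_root d k ^ (d - f S) * cnj (unit_root d k) ^ f S * g S)
    = of_nat (Suc d) * (\<Sum>S | S \<in> X \<and> f S = d div 2. g S)"
proof -
  have "(\<Sum>k<Suc d. \<Sum>S\<in>X. unit_root d k ^ (d - f S) * cnj (unit_root d k) ^ f S * g S)
      = (\<Sum>S\<in>X. (\<Sum>k<Suc d. unit_root d k ^ (d - f S) * cnj (unit_root d k) ^ f S) * g S)"
    by (subst sum.swap) (simp only: sum_distrib_right)
  also have "\<dots> = (\<Sum>S\<in>X. if f S = d div 2 then of_nat (Suc d) * g S else 0)"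
    using assms by (intro sum.cong refl) (auto simp: sum_unit_root_monomial simp del: sum.lessThan_Suc)
  also have "\<dots> = of_nat (Suc d) * (\<Sum>S | S \<in> X \<and> f S = d div 2. g S)"
    by (simp only: sum.inter_filter[OF assms(2), symmetric] sum_distrib_left)
  finally show ?thesis .
qed

text \<open>
  Averaging over the roots of unity keeps, in the expansion of the traces, exactly the selections of
  half of the positions; their sum is \<open>T_part\<close> up to the binomial coefficient in its denominator.
\<close>

lemma average_cycle_trace:
  assumes A: "A \<in> carrier_mat n n" and "even d"
  shows "(\<Sum>k<Suc d. cycle_trace (rotated_real_part A (unit_root d k)) d)
    = of_nat (Suc d * (d choose (d div 2))) * (\<Sum>p\<in>partitions d. T_part p A / of_nat (z_part p))"
proof -
  let ?B = "\<lambda>k. rotated_real_part A (unit_root d k)"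
  have "(\<Sum>k<Suc d. \<Prod>m\<leftarrow>p. mat_trace (?B k ^\<^sub>m m)) = of_nat (Suc d * (d choose (d div 2))) * T_part p A"
    if "p \<in> partitions d" for p
  proof -
    have d: "sum_list p = d" using that by (simp add: partitions_def)
    let ?g = "\<lambda>S. \<Prod>j<length p. mat_trace (block_word A S j (p ! j))"
    have "(\<Sum>k<Suc d. \<Prod>m\<leftarrow>p. mat_trace (?B k ^\<^sub>m m))
        = (\<Sum>k<Suc d. \<Sum>S\<in>Pow (positions p).
            unit_root d k ^ (d - card S) * cnj (unit_root d k) ^ card S * ?g S)"
      using prod_trace_pow_combination[OF A, where p = p]
      by (simp add: prod.list_conv_set_nth rotated_real_part_def d atLeast0LessThan del: sum.lessThan_Suc)
    also have "\<dots> = of_nat (Suc d) * (\<Sum>S | S \<in> Pow (positions p) \<and> card S = d div 2. ?g S)"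
      using assms(2) d card_mono[OF finite_positions[of p]]
      by (intro sum_unit_root_filter) (auto simp: finite_positions card_positions)
    also have "(\<Sum>S | S \<in> Pow (positions p) \<and> card S = d div 2. ?g S)
        = of_nat (d choose (d div 2)) * T_part p A"
      by (simp add: T_part_def d)
    finally show ?thesis by (simp only: of_nat_mult mult.assoc)
  qed
  then show ?thesis
    unfolding cycle_sum_def
    by (subst sum.swap) (simp add: sum_distrib_left sum_divide_distrib[symmetric] del: sum.lessThan_Suc)
qed

text \<open>
  The same average for the \<open>d\<close>-th powers of the traces produces the same binomial coefficient, which
  therefore cancels in the comparison.
\<close>

lemma average_trace_power:
  assumes "even d"
  shows "(\<Sum>k<Suc d. (2 * Re (unit_root d k * t)) ^ d)
    = real (Suc d * (d choose (d div 2))) * cmod t ^ d"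
proof -
  have "complex_of_real (\<Sum>k<Suc d. (2 * Re (unit_root d k * t)) ^ d)
      = (\<Sum>k<Suc d. (cnj (unit_root d k * t) + unit_root d k * t) ^ d)"
    by (simp only: of_real_sum of_real_power complex_add_cnj add.commute[of "cnj _"])
  also have "\<dots> = (\<Sum>k<Suc d. \<Sum>s\<le>d. unit_root d k ^ (d - s) * cnj (unit_root d k) ^ s
      * (of_nat (d choose s) * cnj t ^ s * t ^ (d - s)))"
    unfolding binomial_ring by (simp only: complex_cnj_mult power_mult_distrib ac_simps)
  also have "\<dots> = of_nat (Suc d) * (\<Sum>s | s \<in> {..d} \<and> s = d div 2. of_nat (d choose s) * cnj t ^ s * t ^ (d - s))"
    by (rule sum_unit_root_filter[where f = "\<lambda>s. s"]) (use assms in auto)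
  also have "{s. s \<in> {..d} \<and> s = d div 2} = {d div 2}" by auto
  also have "(\<Sum>s\<in>{d div 2}. of_nat (d choose s) * cnj t ^ s * t ^ (d - s))
      = of_nat (d choose (d div 2)) * (t * cnj t) ^ (d div 2)"
    using assms by (auto simp: power_mult_distrib elim!: evenE)
  also have "(t * cnj t) ^ (d div 2) = of_real (cmod t ^ d)"
    using assms by (auto simp: complex_norm_square[symmetric] power_mult elim!: evenE)
  finally have "complex_of_real (\<Sum>k<Suc d. (2 * Re (unit_root d k * t)) ^ d)
      = of_real (real (Suc d * (d choose (d div 2))) * cmod t ^ d)"
    by (simp only: of_real_mult of_real_of_nat_eq of_nat_mult mult.assoc)
  then show ?thesis by (simp only: of_real_eq_iff)
qed

section \<open>The general inequality and its equality case\<close>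

text \<open>
  Entrywise, the two rotated real parts are two linear equations for \<open>A\<close> and its adjoint; their
  determinant is nonzero by assumption, and Cramer's rule gives the entries of \<open>A\<close>.
\<close>

lemma scalar_of_rotated_real_parts:
  assumes A: "A \<in> carrier_mat n n" and zw: "z * cnj w \<noteq> w * cnj z"
    and "\<exists>a. rotated_real_part A z = a \<cdot>\<^sub>m 1\<^sub>m n" "\<exists>b. rotated_real_part A w = b \<cdot>\<^sub>m 1\<^sub>m n"
  shows "\<exists>c. A = c \<cdot>\<^sub>m 1\<^sub>m n"
proof -
  obtain a b where a: "rotated_real_part A z = a \<cdot>\<^sub>m 1\<^sub>m n" and b: "rotated_real_part A w = b \<cdot>\<^sub>m 1\<^sub>m n"
    using assms(3,4) by blast
  let ?D = "z * cnj w - w * cnj z" and ?\<delta> = "\<lambda>i j. if i = j then 1 else 0 :: complex"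
  have D: "?D \<noteq> 0" using zw by simp
  have "A $$ (i, j) = (a * cnj w - b * cnj z) / ?D * ?\<delta> i j" if ij: "i < n" "j < n" for i j
  proof -
    have "u * A $$ (i, j) + cnj u * cnj (A $$ (j, i)) = rotated_real_part A u $$ (i, j)" for u
      using ij A mat_adjoint_carrier[OF A] by (simp add: rotated_real_part_def mat_adjoint_index[OF A])
    then have "z * A $$ (i, j) + cnj z * cnj (A $$ (j, i)) = a * ?\<delta> i j"
      "w * A $$ (i, j) + cnj w * cnj (A $$ (j, i)) = b * ?\<delta> i j"
      using ij a b by simp_all
    moreover have "?D * A $$ (i, j) = (z * A $$ (i, j) + cnj z * cnj (A $$ (j, i))) * cnj w
        - (w * A $$ (i, j) + cnj w * cnj (A $$ (j, i))) * cnj z"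
      by (simp add: algebra_simps)
    ultimately have "?D * A $$ (i, j) = (a * ?\<delta> i j) * cnj w - (b * ?\<delta> i j) * cnj z"
      by simp
    then show ?thesis using D by (simp add: field_simps)
  qed
  then have "A = ((a * cnj w - b * cnj z) / ?D) \<cdot>\<^sub>m 1\<^sub>m n"
    using A by (intro eq_matI) auto
  then show ?thesis by blast
qed

lemma unit_root_independent:
  assumes "2 \<le> d"
  shows "unit_root d 0 * cnj (unit_root d 1) \<noteq> unit_root d 1 * cnj (unit_root d 0)"
proof -
  let ?\<theta> = "2 * pi / real (Suc d)"
  have "0 < ?\<theta>" "?\<theta> < pi"
    using assms by (simp_all add: field_simps)
  then have "sin ?\<theta> > 0" by (rule sin_gt_zero)
  moreover have "unit_root d 0 = 1" "unit_root d 1 = cis ?\<theta>"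
    by (simp_all add: unit_root_def)
  ultimately show ?thesis by (simp add: complex_eq_iff del: of_nat_Suc)
qed

theorem theorem32:
  fixes A :: "complex mat" and n d :: nat
  assumes "1 \<le> n" and "A \<in> carrier_mat n n" and "2 \<le> d" and "even d"
  shows "chs_norm d A \<ge> root d (real ((n + d - 1) choose d)) * (cmod (mat_trace A) / real n)
    \<and> (chs_norm d A = root d (real ((n + d - 1) choose d)) * (cmod (mat_trace A) / real n)
        \<longleftrightarrow> (\<exists>c. A = c \<cdot>\<^sub>m 1\<^sub>m n))"
proof -
  note A = assms(2)
  let ?B = "\<lambda>k. rotated_real_part A (unit_root d k)"
  let ?t = "\<lambda>k. 2 * Re (unit_root d k * mat_trace A)"
  \<comment> \<open>\<open>S\<close> and, further down, \<open>L\<close> are the \<open>d\<close>-th powers of the two sides; \<open>K\<close> is the common factor of their expressions as sums over the roots of unity.\<close>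
  define c where "c = real ((n + d - 1) choose d)"
  define S where "S = Re (\<Sum>p\<in>partitions d. T_part p A / of_nat (z_part p))"
  define K where "K = real (Suc d * (d choose (d div 2)))"
  have "0 < d choose (d div 2)" by (simp add: zero_less_binomial)
  then have K: "0 < K" unfolding K_def of_nat_0_less_iff by simp
  have "\<exists>h. cycle_trace (?B k) d = of_real h \<and> c * (?t k / n) ^ d \<le> h
      \<and> (h = c * (?t k / n) ^ d \<longleftrightarrow> (\<exists>a. ?B k = a \<cdot>\<^sub>m 1\<^sub>m n))" for k
    using hermitian_cycle_trace[OF rotated_real_part(1,2)[OF A] assms(1,4,3) rotated_real_part(3)[OF A]]
    unfolding c_def by metis
  then obtain h where h: "\<And>k. cycle_trace (?B k) d = of_real (h k)"
    and le: "\<And>k. c * (?t k / n) ^ d \<le> h k"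
    and eq: "\<And>k. h k = c * (?t k / n) ^ d \<longleftrightarrow> (\<exists>a. ?B k = a \<cdot>\<^sub>m 1\<^sub>m n)"
    by metis
  have KS: "K * S = (\<Sum>k<Suc d. h k)"
  proof -
    have "(\<Sum>k<Suc d. h k) = Re (\<Sum>k<Suc d. cycle_trace (?B k) d)"
      by (simp only: h Re_sum Re_complex_of_real)
    also have "\<dots> = K * S"
      unfolding average_cycle_trace[OF A assms(4)] K_def S_def times_complex.sel
      by (simp only: complex_Re_of_nat complex_Im_of_nat mult_zero_left diff_0_right)
    finally show ?thesis by simp
  qed
  define L where "L = c * (cmod (mat_trace A) / n) ^ d"
  have KL: "K * L = (\<Sum>k<Suc d. c * (?t k / n) ^ d)"
    using average_trace_power[OF assms(4), of "mat_trace A"]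
    by (simp only: power_divide times_divide_eq_right sum_distrib_left[symmetric] sum_divide_distrib[symmetric]
        K_def L_def ac_simps)
  have "K * L \<le> K * S"
    unfolding KS KL by (intro sum_mono le)
  then have LS: "L \<le> S" using K by simp
  have "S = L \<longleftrightarrow> (\<exists>c. A = c \<cdot>\<^sub>m 1\<^sub>m n)"
  proof
    assume "S = L"
    then have "(\<Sum>k<Suc d. h k) = (\<Sum>k<Suc d. c * (?t k / n) ^ d)" using KS KL by simp
    then have "\<forall>k\<in>{..<Suc d}. h k - c * (?t k / n) ^ d = 0"
      using le by (subst sum_nonneg_eq_0_iff[symmetric]) (auto simp: sum_subtractf)
    then have "\<exists>a. ?B k = a \<cdot>\<^sub>m 1\<^sub>m n" if "k < Suc d" for k
      using eq that by auto
    then show "\<exists>c. A = c \<cdot>\<^sub>m 1\<^sub>m n"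
      using scalar_of_rotated_real_parts[OF A unit_root_independent[OF assms(3)]] assms(3) by simp
  next
    assume "\<exists>c. A = c \<cdot>\<^sub>m 1\<^sub>m n"
    then obtain a where a: "A = a \<cdot>\<^sub>m 1\<^sub>m n" by blast
    have "\<exists>b. ?B k = b \<cdot>\<^sub>m 1\<^sub>m n" for k
      unfolding a using rotated_real_part_scalar by blast
    then have "h k = c * (?t k / n) ^ d" for k using eq by blast
    then have "K * S = K * L" unfolding KS KL by simp
    then show "S = L" using K by simp
  qed
  moreover have "chs_norm d A = root d S" by (simp add: chs_norm_def S_def)
  moreover have "root d c * (cmod (mat_trace A) / n) = root d L"
    using assms(3) unfolding L_def real_root_mult by (simp add: real_root_power_cancel)
  moreover have "root d L \<le> root d S \<and> (root d S = root d L \<longleftrightarrow> S = L)"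
    using LS assms(3) by simp
  ultimately show ?thesis unfolding c_def by simp
qed

end
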